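(* Let $V$ be a finite set, let $\mathcal{M}=(V,\mathcal{F})$ be a matroid all of whose bases have cardinality $N$, and let $f:2^V\to\mathbb{R}$ be an increasing set function with submodularity ratio $\gamma$ and curvature $\alpha$. Let $S^*$ be an optimal solution of $$\min_{S\subseteq V} f(S)\quad\text{s.t.}\quad S\in\mathcal{F},\ |S|=N,$$ and let $S^{\mathsf f}$ be any output of the forward greedy algorithm applied to this problem. Let $\gamma^{\mathsf{fg}}$ be the largest $\tilde\gamma\in[0,1]$ such that $\tilde\gamma\rho_s(S)\le\rho_s(\emptyset)$ for all $S\in\mathcal{F}$ with $|S|\le N-1$ and all $s\in V\setminus S$ with $S\cup s\in\mathcal{F}$. Let $\alpha^{\mathsf{fg}}$ be the smallest $\tilde\alpha\in[0,1]$ such that $\rho_s(S)\ge(1-\tilde\alpha)\rho_s(\emptyset)$ for all $S\in\mathcal{F}$ with $|S|\le N-1$ and all $s\in V\setminus S$ with $S\cup s\in\mathcal{F}$. Assume $\gamma^{\mathsf{fg}}>0$, $\alpha^{\mathsf{fg}}<1$ and $f(S^* )\ne f(\emptyset)$. Then $\gamma^{\mathsf{fg}}\ge\gamma$, $\alpha^{\mathsf{fg}}\le\alpha$, and $$\frac{f(S^{\mathsf f})-f(\emptyset)}{f(S^* )-f(\emptyset)}\le\frac{1}{\gamma^{\mathsf{fg}}(1-\alpha^{\mathsf{fg}})},$$ or equivalently, $$f(S^{\mathsf f})\le\frac{1}{\gamma^{\mathsf{fg}}(1-\alpha^{\mathsf{fg}})}f(S^* )+\left(1-\frac{1}{\g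amma^{\mathsf{fg}}(1-\alpha^{\mathsf{fg}})}\right)f(\emptyset).$$
   Context: Notation: $j$ and $\{j\}$ are identified for singletons; $\rho_j(S)=f(S\cup j)-f(S)$ for $S\subseteq V$, $j\in V$. The function $f$ is not assumed normalized. $f$ is increasing if $f(S)\le f(R)$ for all $S\subseteq R\subseteq V$. The submodularity ratio of an increasing $f$ is the largest $\gamma\in\mathbb{R}_+$ such that $\gamma\rho_j(R)\le\rho_j(S)$ for all $S\subseteq R\subseteq V$ and all $j\in V\setminus R$ (one has $\gamma\in[0,1]$). The curvature of an increasing $f$ is the smallest $\alpha\in\mathbb{R}_+$ such that $\rho_j(R)\ge(1-\alpha)\rho_j(S)$ for all $S\subseteq R\subseteq V$ and all $j\in V\setminus R$ (one has $\alpha\in[0,1]$). A matroid $(V,\mathcal{F})$ is given by its collection $\mathcal{F}$ of independent sets; bases are the independent sets of maximum cardinality. Forward greedy algorithm: start with $S^0=\emptyset$ and with no element of $V$ marked as considered. For $t=1,\dots,N$: repeatedly choose $j\in\arg\min\rho_j(S^{t-1})$ over all not yet considered elements $j\in V$ (ties broken arbitrarily) and mark $j$ as considered (permanently); if $S^{t-1}\cup j\notin\mathcal{F}$, discard $j$ and choose again; otherwise set $s_t=j$, $S^t=S^{t-1}\cup j$ and proceed to the next $t$. The output is $S^{\mathsf f}=S^N$. The quantities $\gamma^{\mathsf{fg}}$ and $\alpha^{\mathsf{fg}}$ are called the forward greedy submodularity ratio and forward greedy curvature. *)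

theory Defs
  imports Complex_Main
begin

locale matroid =
  fixes V :: "'a set" and F :: "'a set set"
  assumes finite_ground: "finite V"
    and indep_subset_ground: "F \<subseteq> Pow V"
    and empty_indep: "{} \<in> F"
    and indep_hereditary: "\<lbrakk>B \<in> F; A \<subseteq> B\<rbrakk> \<Longrightarrow> A \<in> F"
    and indep_augment: "\<lbrakk>A \<in> F; B \<in> F; card A < card B\<rbrakk> \<Longrightarrow> \<exists>x\<in>B - A. insert x A \<in> F"

definition matroid_base :: "'a set set \<Rightarrow> 'a set \<Rightarrow> bool" where
  "matroid_base F B \<longleftrightarrow> B \<in> F \<and> (\<forall>A\<in>F. card A \<le> card B)"

text \<open>The marginal \<open>\<rho> f j S\<close> is the increment written \<open>\<rho>\<^sub>j(S)\<close> when \<open>f\<close> is clear.\<close>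

definition \<rho> :: "('a set \<Rightarrow> real) \<Rightarrow> 'a \<Rightarrow> 'a set \<Rightarrow> real" where
  "\<rho> f j S = f (insert j S) - f S"

definition is_largest :: "real set \<Rightarrow> real \<Rightarrow> bool" where
  "is_largest A x \<longleftrightarrow> x \<in> A \<and> (\<forall>y\<in>A. y \<le> x)"

definition is_smallest :: "real set \<Rightarrow> real \<Rightarrow> bool" where
  "is_smallest A x \<longleftrightarrow> x \<in> A \<and> (\<forall>y\<in>A. x \<le> y)"

text \<open>The four quantities below are predicates rather than functions: if \<open>f\<close> is constant on
  the subsets of \<open>V\<close>, every \<open>\<gamma> \<ge> 0\<close> satisfies the inequality and
  there is no largest one. For every other increasing \<open>f\<close> on a finite ground set the
  submodularity ratio exists; the other three quantities always exist.\<close>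

definition is_submodularity_ratio :: "'a set \<Rightarrow> ('a set \<Rightarrow> real) \<Rightarrow> real \<Rightarrow> bool" where
  "is_submodularity_ratio V f \<gamma> \<longleftrightarrow>
     is_largest {g. g \<ge> 0 \<and> (\<forall>S R. \<forall>j\<in>V - R. S \<subseteq> R \<and> R \<subseteq> V \<longrightarrow> g * \<rho> f j R \<le> \<rho> f j S)} \<gamma>"

definition is_curvature :: "'a set \<Rightarrow> ('a set \<Rightarrow> real) \<Rightarrow> real \<Rightarrow> bool" where
  "is_curvature V f \<alpha> \<longleftrightarrow>
     is_smallest {a. a \<ge> 0 \<and> (\<forall>S R. \<forall>j\<in>V - R. S \<subseteq> R \<and> R \<subseteq> V \<longrightarrow> \<rho> f j R \<ge> (1 - a) * \<rho> f j S)} \<alpha>"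

text \<open>The condition \<open>card S < N\<close> stands for \<open>|S| \<le> N - 1\<close>, avoiding truncated
  subtraction.\<close>

definition is_fg_submodularity_ratio ::
  "'a set \<Rightarrow> 'a set set \<Rightarrow> nat \<Rightarrow> ('a set \<Rightarrow> real) \<Rightarrow> real \<Rightarrow> bool" where
  "is_fg_submodularity_ratio V F N f \<gamma> \<longleftrightarrow>
     is_largest {g \<in> {0..1}. \<forall>S\<in>F. \<forall>s\<in>V - S. card S < N \<and> insert s S \<in> F \<longrightarrow>
                   g * \<rho> f s S \<le> \<rho> f s {}} \<gamma>"

definition is_fg_curvature ::
  "'a set \<Rightarrow> 'a set set \<Rightarrow> nat \<Rightarrow> ('a set \<Rightarrow> real) \<Rightarrow> real \<Rightarrow> bool" where
  "is_fg_curvature V F N f \<alpha> \<longleftrightarrow>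
     is_smallest {a \<in> {0..1}. \<forall>S\<in>F. \<forall>s\<in>V - S. card S < N \<and> insert s S \<in> F \<longrightarrow>
                   \<rho> f s S \<ge> (1 - a) * \<rho> f s {}} \<alpha>"

text \<open>\<open>fg_state V F N f t S U\<close>: some run of the forward greedy algorithm, under some
  tie-breaking, reaches a point where \<open>t\<close> elements have been accepted, the current set is
  \<open>S\<close>, and \<open>U\<close> is the set of elements already marked as considered.\<close>

inductive fg_state ::
  "'a set \<Rightarrow> 'a set set \<Rightarrow> nat \<Rightarrow> ('a set \<Rightarrow> real) \<Rightarrow> nat \<Rightarrow> 'a set \<Rightarrow> 'a set \<Rightarrow> bool"
  for V F N f where
  init: "fg_state V F N f 0 {} {}"
| discard: "\<lbrakk>fg_state V F N f t S U; t < N;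
     is_arg_min (\<lambda>i. \<rho> f i S) (\<lambda>i. i \<in> V - U) j; insert j S \<notin> F\<rbrakk>
     \<Longrightarrow> fg_state V F N f t S (insert j U)"
| accept: "\<lbrakk>fg_state V F N f t S U; t < N;
     is_arg_min (\<lambda>i. \<rho> f i S) (\<lambda>i. i \<in> V - U) j; insert j S \<in> F\<rbrakk>
     \<Longrightarrow> fg_state V F N f (Suc t) (insert j S) (insert j U)"

definition fg_output ::
  "'a set \<Rightarrow> 'a set set \<Rightarrow> nat \<Rightarrow> ('a set \<Rightarrow> real) \<Rightarrow> 'a set \<Rightarrow> bool" where
  "fg_output V F N f S \<longleftrightarrow> (\<exists>U. fg_state V F N f N S U)"

end

theory Submission
  imports Defs
begin

text \<open>Write \<open>w(j) = \<rho>\<^sub>j(\<emptyset>)\<close>. Both sides of the bound are compared with the modular weight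
  \<open>w(S\<^sup>*) = (\<Sum>j\<in>S\<^sup>*. w(j))\<close> of the optimal base.

  From below, building \<open>S\<^sup>*\<close> element by element and applying the curvature inequality to each
  increment gives \<open>(1 - \<alpha>\<^sup>f\<^sup>g) w(S\<^sup>*) \<le> f(S\<^sup>*) - f(\<emptyset>)\<close> (\<open>curvature_bound\<close>).

  From above, \<open>\<gamma>\<^sup>f\<^sup>g (f(S\<^sup>f) - f(\<emptyset>)) \<le> w(S\<^sup>*)\<close> (\<open>greedy_bound\<close>), because the elements of \<open>S\<^sup>*\<close>
  can be paired with the greedy steps: the element \<open>x\<close> paired with step \<open>t\<close> is one that augments
  \<open>S\<^sup>t\<^sup>-\<^sup>1\<close>. Since considered elements are either in the current set or dependent on it
  (\<open>fg_state_invariant\<close>), \<open>x\<close> is still available at step \<open>t\<close>, so the greedy increment is at most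
  \<open>\<rho>\<^sub>x(S\<^sup>t\<^sup>-\<^sup>1)\<close>, which the submodularity ratio bounds by \<open>w(x) / \<gamma>\<^sup>f\<^sup>g\<close>. The pairing is found from the
  last step backwards, which is exactly an induction over the run with the independent set
  compared against left arbitrary.

  Chaining the two bounds and dividing by \<open>f(S\<^sup>*) - f(\<emptyset>) > 0\<close> gives the ratio. The comparisons
  \<open>\<gamma> \<le> \<gamma>\<^sup>f\<^sup>g\<close> and \<open>\<alpha>\<^sup>f\<^sup>g \<le> \<alpha>\<close> hold because the greedy quantities impose fewer inequalities;
  only membership in \<open>[0,1]\<close> needs an argument.\<close>

lemma (in matroid) indep_finite: "S \<in> F \<Longrightarrow> finite S"
  using indep_subset_ground finite_ground finite_subset by blast

text \<open>Discarded elements stay dependent as the current set grows, by heredity. Hence an element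
  that augments the current set has never been considered.\<close>

lemma (in matroid) fg_state_invariant:
  assumes "fg_state V F N f t S U"
  shows "S \<in> F \<and> card S = t \<and> S \<subseteq> U \<and> (\<forall>j\<in>U - S. insert j S \<notin> F)"
  using assms
proof (induction rule: fg_state.induct)
  case init
  then show ?case using empty_indep by simp
next
  case (discard t S U j)
  then show ?case by auto
next
  case (accept t S U j)
  have "j \<notin> S"
    using accept by (auto simp: is_arg_min_def)
  then have "card (insert j S) = Suc t"
    using accept.IH indep_finite by simp
  moreover have "insert i (insert j S) \<notin> F" if "i \<in> insert j U - insert j S" for i
    using that accept.IH indep_hereditary[of "insert i (insert j S)" "insert i S"] by auto
  ultimately show ?case using accept by auto
qed

text \<open>Comparing with every independent set \<open>T\<close> of size \<open>t\<close>, rather than with a fixed base, is what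
  makes the induction work: the augmenting element \<open>x\<close> accounts for the current step and
  \<open>T - {x}\<close> is passed to the earlier ones.\<close>

lemma (in matroid) greedy_bound:
  assumes ratio: "\<And>S s. \<lbrakk>S \<in> F; s \<in> V - S; card S < N; insert s S \<in> F\<rbrakk>
                    \<Longrightarrow> g * \<rho> f s S \<le> \<rho> f s {}"
    and "g \<ge> 0"
    and run: "fg_state V F N f t S U"
    and "T \<in> F" "card T = t"
  shows "g * (f S - f {}) \<le> (\<Sum>j\<in>T. \<rho> f j {})"
  using run \<open>T \<in> F\<close> \<open>card T = t\<close>
proof (induction arbitrary: T rule: fg_state.induct)
  case init
  then show ?case using indep_finite by simp
next
  case (discard t S U j)
  then show ?case by blast
next
  case (accept t S U j)
  have inv: "S \<in> F" "card S = t" "\<forall>j\<in>U - S. insert j S \<notin> F"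
    using fg_state_invariant[OF accept.hyps(1)] by auto
  obtain x where x: "x \<in> T - S" "insert x S \<in> F"
    using indep_augment[of S T] inv accept.prems by auto
  then have avail: "x \<in> V - U" "x \<in> V - S"
    using inv indep_subset_ground by auto
  have "T - {x} \<in> F"
    using accept.prems indep_hereditary by blast
  moreover have "card (T - {x}) = t"
    using accept.prems x by simp
  ultimately have IH: "g * (f S - f {}) \<le> (\<Sum>j\<in>T - {x}. \<rho> f j {})"
    using accept.IH by blast
  have "\<rho> f j S \<le> \<rho> f x S"
    using accept.hyps(3) avail by (auto simp: is_arg_min_def not_less)
  then have "g * \<rho> f j S \<le> g * \<rho> f x S"
    using \<open>g \<ge> 0\<close> by (rule mult_left_mono)
  also have "\<dots> \<le> \<rho> f x {}"
    using ratio inv avail x accept.hyps(2) by blast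
  finally have step: "g * \<rho> f j S \<le> \<rho> f x {}" .
  have "g * (f (insert j S) - f {}) = g * (f S - f {}) + g * \<rho> f j S"
    by (simp add: \<rho>_def algebra_simps)
  also have "\<dots> \<le> (\<Sum>j\<in>T - {x}. \<rho> f j {}) + \<rho> f x {}"
    using IH step by linarith
  also have "\<dots> = (\<Sum>j\<in>T. \<rho> f j {})"
    using x accept.prems indep_finite sum.remove[of T x "\<lambda>j. \<rho> f j {}"] by simp
  finally show ?case .
qed

lemma (in matroid) curvature_bound:
  fixes N :: nat
  assumes curv: "\<And>S s. \<lbrakk>S \<in> F; s \<in> V - S; card S < N; insert s S \<in> F\<rbrakk>
                   \<Longrightarrow> (1 - a) * \<rho> f s {} \<le> \<rho> f s S"
    and "T \<in> F" "card T \<le> N"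
  shows "(1 - a) * (\<Sum>j\<in>T. \<rho> f j {}) \<le> f T - f {}"
  using indep_finite[OF \<open>T \<in> F\<close>] \<open>T \<in> F\<close> \<open>card T \<le> N\<close>
proof (induction T rule: finite_induct)
  case empty
  then show ?case by simp
next
  case (insert x T)
  have "T \<in> F"
    using insert.prems indep_hereditary by blast
  moreover from this have "(1 - a) * (\<Sum>j\<in>T. \<rho> f j {}) \<le> f T - f {}"
    using insert by simp
  moreover have "x \<in> V - T"
    using insert indep_subset_ground by auto
  ultimately show ?case
    using curv[of T x] insert by (simp add: \<rho>_def algebra_simps)
qed

text \<open>A ratio above \<open>1\<close> would, on taking \<open>R = S\<close>, force every increment to be at most \<open>0\<close>, hence to
  vanish by monotonicity; then every nonnegative number would satisfy the defining inequality and
  no largest ratio would exist.\<close>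

lemma submodularity_ratio_le_1:
  assumes mono: "mono_on (Pow V) f" and ratio: "is_submodularity_ratio V f \<gamma>"
  shows "\<gamma> \<le> 1"
proof (rule ccontr)
  assume "\<not> \<gamma> \<le> 1"
  then have "\<gamma> > 1" by simp
  have ineq: "\<gamma> * \<rho> f j R \<le> \<rho> f j S" if "S \<subseteq> R" "R \<subseteq> V" "j \<in> V - R" for S R j
    using ratio that by (auto simp: is_submodularity_ratio_def is_largest_def)
  have zero: "\<rho> f j R = 0" if "R \<subseteq> V" "j \<in> V - R" for R j
  proof -
    have "0 \<le> \<rho> f j R"
      using monotone_onD[OF mono, of R "insert j R"] that by (auto simp: \<rho>_def)
    moreover have "(\<gamma> - 1) * \<rho> f j R \<le> 0"
      using ineq[of R R j] that by (simp add: algebra_simps)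
    ultimately show ?thesis
      using \<open>\<gamma> > 1\<close> by (simp add: mult_le_0_iff)
  qed
  have "(\<gamma> + 1) * \<rho> f j R \<le> \<rho> f j S" if "S \<subseteq> R" "R \<subseteq> V" "j \<in> V - R" for S R j
    using zero[OF that(2,3)] zero[of S j] that by force
  then have "\<gamma> + 1 \<in> {g. g \<ge> 0 \<and> (\<forall>S R. \<forall>j\<in>V - R. S \<subseteq> R \<and> R \<subseteq> V \<longrightarrow> g * \<rho> f j R \<le> \<rho> f j S)}"
    using \<open>\<gamma> > 1\<close> by simp
  then have "\<gamma> + 1 \<le> \<gamma>"
    using ratio unfolding is_submodularity_ratio_def is_largest_def by blast
  then show False by simp
qed

lemma (in matroid) submodularity_ratio_le_fg:
  assumes mono: "mono_on (Pow V) f"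
    and ratio: "is_submodularity_ratio V f \<gamma>"
    and fg: "is_fg_submodularity_ratio V F N f \<gamma>fg"
  shows "\<gamma> \<le> \<gamma>fg"
proof -
  have "\<gamma> * \<rho> f s S \<le> \<rho> f s {}" if "S \<in> F" "s \<in> V - S" for S s
    using ratio that indep_subset_ground
    by (auto simp: is_submodularity_ratio_def is_largest_def)
  moreover have "0 \<le> \<gamma>"
    using ratio by (simp add: is_submodularity_ratio_def is_largest_def)
  ultimately show ?thesis
    using fg submodularity_ratio_le_1[OF mono ratio]
    by (simp add: is_fg_submodularity_ratio_def is_largest_def)
qed

lemma (in matroid) fg_curvature_le:
  assumes curv: "is_curvature V f \<alpha>"
    and fg: "is_fg_curvature V F N f \<alpha>fg"
  shows "\<alpha>fg \<le> \<alpha>"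
proof (cases "\<alpha> \<le> 1")
  case True
  have "(1 - \<alpha>) * \<rho> f s {} \<le> \<rho> f s S" if "S \<in> F" "s \<in> V - S" for S s
    using curv that indep_subset_ground
    by (auto simp: is_curvature_def is_smallest_def)
  moreover have "0 \<le> \<alpha>"
    using curv by (simp add: is_curvature_def is_smallest_def)
  ultimately show ?thesis
    using fg True by (simp add: is_fg_curvature_def is_smallest_def)
next
  case False
  then show ?thesis
    using fg by (simp add: is_fg_curvature_def is_smallest_def)
qed

theorem corollary1:
  fixes V :: "'a set" and F :: "'a set set" and N :: nat and f :: "'a set \<Rightarrow> real"
    and \<gamma> \<alpha> \<gamma>fg \<alpha>fg :: real and Sopt Sf :: "'a set"
  assumes "matroid V F"
    and "\<And>B. matroid_base F B \<Longrightarrow> card B = N"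
    and "mono_on (Pow V) f"
    and "is_submodularity_ratio V f \<gamma>"
    and "is_curvature V f \<alpha>"
    and "is_arg_min f (\<lambda>S. S \<subseteq> V \<and> S \<in> F \<and> card S = N) Sopt"
    and "fg_output V F N f Sf"
    and "is_fg_submodularity_ratio V F N f \<gamma>fg"
    and "is_fg_curvature V F N f \<alpha>fg"
    and "\<gamma>fg > 0"
    and "\<alpha>fg < 1"
    and "f Sopt \<noteq> f {}"
  shows "\<gamma>fg \<ge> \<gamma> \<and> \<alpha>fg \<le> \<alpha>
    \<and> (f Sf - f {}) / (f Sopt - f {}) \<le> 1 / (\<gamma>fg * (1 - \<alpha>fg))
    \<and> f Sf \<le> 1 / (\<gamma>fg * (1 - \<alpha>fg)) * f Sopt + (1 - 1 / (\<gamma>fg * (1 - \<alpha>fg))) * f {}"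
proof -
  interpret matroid V F by fact
  let ?c = "\<gamma>fg * (1 - \<alpha>fg)"
  let ?w = "\<Sum>j\<in>Sopt. \<rho> f j {}"
  have opt: "Sopt \<in> F" "Sopt \<subseteq> V" "card Sopt = N"
    using assms(6) by (auto simp: is_arg_min_def)
  obtain U where run: "fg_state V F N f N Sf U"
    using assms(7) by (auto simp: fg_output_def)
  have ratio: "\<gamma>fg * \<rho> f s S \<le> \<rho> f s {}"
    if "S \<in> F" "s \<in> V - S" "card S < N" "insert s S \<in> F" for S s
    using assms(8) that by (auto simp: is_fg_submodularity_ratio_def is_largest_def)
  have curv: "(1 - \<alpha>fg) * \<rho> f s {} \<le> \<rho> f s S"
    if "S \<in> F" "s \<in> V - S" "card S < N" "insert s S \<in> F" for S s
    using assms(9) that by (auto simp: is_fg_curvature_def is_smallest_def)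
  have "\<gamma>fg * (f Sf - f {}) \<le> ?w"
    by (rule greedy_bound[OF ratio less_imp_le[OF assms(10)] run opt(1) opt(3)])
  then have "(1 - \<alpha>fg) * (\<gamma>fg * (f Sf - f {})) \<le> (1 - \<alpha>fg) * ?w"
    using assms(11) by (intro mult_left_mono) auto
  also have "\<dots> \<le> f Sopt - f {}"
    by (rule curvature_bound[OF curv opt(1) eq_imp_le[OF opt(3)]])
  finally have main: "?c * (f Sf - f {}) \<le> f Sopt - f {}"
    by (simp add: mult_ac)
  have c: "?c > 0"
    using assms(10,11) by simp
  have bound: "f Sf - f {} \<le> 1 / ?c * (f Sopt - f {})"
    using main c by (simp add: pos_le_divide_eq mult_ac)
  have "f {} \<le> f Sopt"
    using monotone_onD[OF assms(3), of "{}" Sopt] opt by auto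
  then have pos: "f Sopt - f {} > 0"
    using assms(12) by simp
  have "(f Sf - f {}) / (f Sopt - f {}) \<le> 1 / ?c"
    using bound pos by (simp only: pos_divide_le_eq)
  moreover have "f Sf \<le> 1 / ?c * f Sopt + (1 - 1 / ?c) * f {}"
    using bound by (simp only: left_diff_distrib right_diff_distrib)
  ultimately show ?thesis
    using submodularity_ratio_le_fg[OF assms(3,4,8)] fg_curvature_le[OF assms(5,9)] by blast
qed

end
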